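(* Every algebraically closed (commutative, infinite) idempotent semifield is preradicable.
   Context: A semiring is a commutative monoid $(S,+,0)$ with an associative multiplication having identity $1$, distributing over $+$, and with $0$ absorbing. A semifield is a semiring with $1\neq 0$ in which every nonzero element has a multiplicative inverse; it is idempotent if $x+x=x$ for all $x$. All idempotent semifields are assumed commutative and infinite. An idempotent semifield $K$ is ordered by $x\leqslant y \iff x+y=y$. $\mathbb{N}$ contains $0$ and $\mathbb{N}^*=\mathbb{N}\setminus\{0\}$. A polynomial $p\in K[X]$ is a formal polynomial $p=\sum_{j\in\mathbb{N}}p_jX^j$ (eventually zero sequence of coefficients), with polynomial function $\widehat p:K\to K$, $\widehat p(x)=\sum_j p_jx^j$. $K$ is algebraically closed if for every $p\in K[X]$ of degree $n>0$ there are $r_1,\dots,r_n\in K$ with $\widehat p(x)=p_n(x+r_1)\cdots(x+r_n)$ for all $x\in K$. $K$ is preradicable if for all $y\in K$ and $n\in\mathbb{N}^*$ there is a least element $x\in K$ such that $x^n\geqslant y$. *)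

theory Defs
  imports "HOL-Computational_Algebra.Polynomial"
begin

text \<open>
  The class \<^class>\<open>comm_semiring_1\<close> already contains commutativity of multiplication,
  the absorption law for \<open>0\<close> and \<open>0 \<noteq> 1\<close>.
\<close>

class comm_semifield = comm_semiring_1 +
  assumes ex_mult_inverse: "a \<noteq> 0 \<Longrightarrow> \<exists>b. a * b = 1"

text \<open>
  The order symbols carry no structure of their own: they are determined by addition.
\<close>

class idempotent_semifield = comm_semifield + ord +
  assumes add_idem: "a + a = a"
    and le_iff_add_eq: "a \<le> b \<longleftrightarrow> a + b = b"
    and less_iff_le_not_le: "a < b \<longleftrightarrow> a \<le> b \<and> \<not> b \<le> a"
begin

subclass order
proof
  fix x y z :: 'a
  show "x < y \<longleftrightarrow> x \<le> y \<and> \<not> y \<le> x"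
    by (rule less_iff_le_not_le)
  show "x \<le> x"
    by (simp add: le_iff_add_eq add_idem)
  show "x \<le> z" if "x \<le> y" "y \<le> z"
    using that by (metis le_iff_add_eq add.assoc)
  show "x = y" if "x \<le> y" "y \<le> x"
    using that by (metis le_iff_add_eq add.commute)
qed

end

text \<open>
  The factorisation is an identity of polynomial functions, not of formal polynomials.
\<close>

definition algebraically_closed :: "'a::comm_semifield itself \<Rightarrow> bool" where
  "algebraically_closed _ \<longleftrightarrow>
     (\<forall>p :: 'a poly. degree p > 0 \<longrightarrow>
        (\<exists>r :: nat \<Rightarrow> 'a. \<forall>x. poly p x = lead_coeff p * (\<Prod>i=1..degree p. x + r i)))"

definition preradicable :: "'a::idempotent_semifield itself \<Rightarrow> bool" where
  "preradicable _ \<longleftrightarrow>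
     (\<forall>(y :: 'a) (n :: nat). n > 0 \<longrightarrow>
        (\<exists>x. x ^ n \<ge> y \<and> (\<forall>z. z ^ n \<ge> y \<longrightarrow> x \<le> z)))"

end

theory Submission
  imports Defs
begin

text \<open>
  Factor \<open>X\<^sup>n + y\<close> as \<open>\<Prod>\<^sub>i (X + r\<^sub>i)\<close>. A nonzero \<open>z\<close> satisfies \<open>z\<^sup>n \<ge> y\<close> iff
  \<open>\<Prod>\<^sub>i (z + r\<^sub>i) = z\<^sup>n\<close>, and since \<open>z + r\<^sub>i \<ge> z\<close> for each \<open>i\<close>, cancellation shows that this
  happens iff \<open>r\<^sub>i \<le> z\<close> for all \<open>i\<close>. Hence the sum of the \<open>r\<^sub>i\<close> is the least solution.
\<close>

lemma comm_semifield_mult_left_cancel: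
  fixes a b c :: "'a::comm_semifield"
  assumes "c \<noteq> 0" and "c * a = c * b"
  shows "a = b"
proof -
  obtain d where d: "c * d = 1"
    using assms(1) ex_mult_inverse by blast
  have "d * (c * a) = d * (c * b)"
    by (simp add: assms(2))
  then have "(c * d) * a = (c * d) * b"
    by (simp only: ac_simps)
  then show ?thesis
    by (simp add: d)
qed

lemma comm_semifield_power_nonzero:
  fixes a :: "'a::comm_semifield"
  assumes "a \<noteq> 0"
  shows "a ^ n \<noteq> 0"
proof (induction n)
  case (Suc n)
  then show ?case
    using comm_semifield_mult_left_cancel[OF assms, of "a ^ n" 0] by auto
qed simp

context idempotent_semifield
begin

lemma le_add_left: "a \<le> a + b"
  by (simp add: le_iff_add_eq add_idem flip: add.assoc)

lemma add_le_iff: "a + b \<le> c \<longleftrightarrow> a \<le> c \<and> b \<le> c"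
  by (metis le_add_left le_iff_add_eq add.assoc add.commute)

lemma bot_le: "0 \<le> a"
  by (simp add: le_iff_add_eq)

lemma mult_left_mono': "a \<le> b \<Longrightarrow> c * a \<le> c * b"
  by (metis le_iff_add_eq distrib_left)

lemma mult_mono': "a \<le> b \<Longrightarrow> c \<le> d \<Longrightarrow> a * c \<le> b * d"
  by (metis mult_left_mono' mult.commute order.trans)

lemma sum_le_iff: "finite A \<Longrightarrow> sum f A \<le> z \<longleftrightarrow> (\<forall>i\<in>A. f i \<le> z)"
  by (induction A rule: finite_induct) (auto simp: bot_le add_le_iff)

text \<open>Every factor is at least \<open>z\<close>. The bound is later applied to the product
  with one factor removed.\<close>

lemma power_card_le_prod:
  "finite A \<Longrightarrow> z ^ card A \<le> (\<Prod>i\<in>A. z + f i)"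
  by (induction A rule: finite_induct) (auto intro: mult_mono' le_add_left)

end

lemma prod_add_eq_power_iff:
  fixes z :: "'a::idempotent_semifield"
  assumes "finite A" and "z \<noteq> 0"
  shows "(\<Prod>i\<in>A. z + f i) = z ^ card A \<longleftrightarrow> sum f A \<le> z"
proof
  assume eq: "(\<Prod>i\<in>A. z + f i) = z ^ card A"
  have "f j \<le> z" if "j \<in> A" for j
  proof -
    let ?w = "z ^ card (A - {j})"
    have card: "card A = Suc (card (A - {j}))"
      using assms(1) that by (rule card.remove)
    \<comment> \<open>Bounding every factor except the \<open>j\<close>-th below by \<open>z\<close>
      squeezes \<open>(z + f j) * ?w\<close> under \<open>z ^ card A = z * ?w\<close>; the reverse
      inequality comes from \<open>z \<le> z + f j\<close>.\<close>
    have "(z + f j) * ?w \<le> (z + f j) * (\<Prod>i\<in>A - {j}. z + f i)"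
      using assms(1) by (intro mult_left_mono' power_card_le_prod) simp
    also have "\<dots> = z * ?w"
      using eq prod.remove[OF assms(1) that, of "\<lambda>i. z + f i"] by (simp add: card)
    finally have "(z + f j) * ?w = z * ?w"
      using mult_mono'[OF le_add_left order.refl] by (rule order.antisym)
    then have "?w * (z + f j) = ?w * z"
      by (simp only: mult.commute)
    \<comment> \<open>\<open>?w\<close> cancels, being a power of the nonzero
      \<open>z\<close>.\<close>
    then have "z + f j = z"
      using comm_semifield_mult_left_cancel comm_semifield_power_nonzero assms(2) by blast
    then show ?thesis
      by (simp add: le_iff_add_eq add.commute)
  qed
  then show "sum f A \<le> z"
    by (simp add: sum_le_iff assms(1))
next
  assume "sum f A \<le> z"
  then have "z + f i = z" if "i \<in> A" for i
    using that sum_le_iff[OF assms(1)] by (metis le_iff_add_eq add.commute)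
  then show "(\<Prod>i\<in>A. z + f i) = z ^ card A"
    by simp
qed

theorem proposition6p4:
  assumes "infinite (UNIV :: 'a::idempotent_semifield set)"
    and "algebraically_closed TYPE('a)"
  shows "preradicable TYPE('a)"
  unfolding preradicable_def
proof (intro allI impI)
  fix y :: 'a and n :: nat
  assume n: "n > 0"
  show "\<exists>x. x ^ n \<ge> y \<and> (\<forall>z. z ^ n \<ge> y \<longrightarrow> x \<le> z)"
  \<comment> \<open>For \<open>y = 0\<close> the bottom element \<open>0\<close> is itself the least
    solution.\<close>
  proof (cases "y = 0")
    case True
    then show ?thesis
      by (auto intro: exI[of _ 0] bot_le)
  next
    case False
    \<comment> \<open>This is \<open>X^n + y\<close>: \<open>pCons\<close> shifts the monomial up by
      one degree, hence the exponent \<open>n - 1\<close>.\<close>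
    define p where "p = pCons y (monom 1 (n - 1))"
    have deg: "degree p = n" and lead: "lead_coeff p = 1"
      using n by (cases n; simp add: p_def degree_monom_eq)+
    have poly: "poly p x = y + x ^ n" for x
      using n by (cases n) (auto simp: p_def poly_monom)
    obtain r where "\<forall>x. poly p x = lead_coeff p * (\<Prod>i=1..degree p. x + r i)"
      using assms(2) n deg unfolding algebraically_closed_def by blast
    then have r: "y + x ^ n = (\<Prod>i=1..n. x + r i)" for x
      using poly[of x] by (simp add: deg lead[unfolded deg])
    have iff: "y \<le> z ^ n \<longleftrightarrow> sum r {1..n} \<le> z" if "z \<noteq> 0" for z
      \<comment> \<open>The left side unfolds to \<open>y + z ^ n = z ^ n\<close>, whose sum
        \<open>r\<close> turns into the product.\<close>
      using prod_add_eq_power_iff[of "{1..n}" z r] that by (simp add: le_iff_add_eq r)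
    have nonzero: "z \<noteq> 0" if "y \<le> z ^ n" for z
      using that False n by (auto simp: le_iff_add_eq power_0_left)
    \<comment> \<open>This lets \<open>iff\<close> be applied to the sum itself, which shows that it
      is a solution. Were it \<open>0\<close>, the bottom element, every \<open>r i\<close> would
      vanish, and the factorisation at \<open>0\<close> would give \<open>y = 0\<close>.\<close>
    have "sum r {1..n} \<noteq> 0"
    proof
      assume "sum r {1..n} = 0"
      then have "r i = 0" if "i \<in> {1..n}" for i
        using that sum_le_iff[of "{1..n}" r 0] by (auto simp: le_iff_add_eq)
      then have "(\<Prod>i=1..n. 0 + r i) = 0 ^ n"
        by simp
      then show False
        using r[of 0] n False by (simp add: power_0_left)
    qed
    then show ?thesis
      using iff nonzero by blast
  qed
qed

end
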